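(* Let $X$ be a full right Hilbert $C^*$-module over a $C^*$-algebra $A$, let $p\in A$ be a projection and let $x_0\in S_p(X)$. Then the mapping $\rho':S_p(X)\to\mathcal E_{x_0}$, $\rho'(x)=\theta_{x,x}$, is a principal bundle with structure group equal to the unitary group $\mathcal U_{pAp}$ of $pAp$ (acting on $S_p(X)$ by right multiplication).
   Context: $X$ full means that the span of $\{\langle x,y\rangle : x,y\in X\}$ is dense in $A$. $\mathcal L_A(X)$ is the $C^*$-algebra of adjointable operators on $X$; for $x,y\in X$, $\theta_{x,y}(z)=x\langle y,z\rangle$. Projection means self-adjoint idempotent. $S_p(X)=\{x\in X:\langle x,x\rangle=p\}$ with the norm topology; if $x\in S_p(X)$ then $x=xp$ and $\theta_{x,x}$ is a projection of $\mathcal L_A(X)$. $\mathcal E_{x_0}$ is the set of projections of $\mathcal L_A(X)$ that are Murray-von Neumann equivalent to $\theta_{x_0,x_0}$, with the norm topology. *)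

theory Defs
  imports "HOL-Analysis.Analysis" "HOL-Algebra.Group"
begin

section \<open>C*-algebras\<close>

class complex_normed_vector = real_normed_vector +
  fixes scaleC :: "complex \<Rightarrow> 'a \<Rightarrow> 'a" (infixr "*\<^sub>C" 75)
  assumes scaleC_add_right: "c *\<^sub>C (x + y) = c *\<^sub>C x + c *\<^sub>C y"
    and scaleC_add_left: "(c + d) *\<^sub>C x = c *\<^sub>C x + d *\<^sub>C x"
    and scaleC_scaleC: "c *\<^sub>C (d *\<^sub>C x) = (c * d) *\<^sub>C x"
    and scaleC_of_real: "complex_of_real r *\<^sub>C x = r *\<^sub>R x"
    and norm_scaleC: "norm (c *\<^sub>C x) = cmod c * norm x"

class complex_banach = complex_normed_vector + banach

text \<open>No unit is required, and the zero algebra is allowed.\<close>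

class cstar_algebra = complex_banach + real_normed_algebra +
  fixes star :: "'a \<Rightarrow> 'a" ("_\<^sup>\<star>" [1000] 1000)
  assumes mult_scaleC_left: "(c *\<^sub>C x) * y = c *\<^sub>C (x * y)"
    and mult_scaleC_right: "x * (c *\<^sub>C y) = c *\<^sub>C (x * y)"
    and star_star: "(x\<^sup>\<star>)\<^sup>\<star> = x"
    and star_add: "(x + y)\<^sup>\<star> = x\<^sup>\<star> + y\<^sup>\<star>"
    and star_scaleC: "(c *\<^sub>C x)\<^sup>\<star> = cnj c *\<^sub>C x\<^sup>\<star>"
    and star_mult: "(x * y)\<^sup>\<star> = y\<^sup>\<star> * x\<^sup>\<star>"
    and cstar_identity: "norm (x\<^sup>\<star> * x) = (norm x)\<^sup>2"

definition projection :: "'a::cstar_algebra \<Rightarrow> bool" where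
  "projection p \<longleftrightarrow> p\<^sup>\<star> = p \<and> p * p = p"

definition positive :: "'a::cstar_algebra \<Rightarrow> bool" where
  "positive a \<longleftrightarrow> (\<exists>b. a = b\<^sup>\<star> * b)"

definition corner :: "'a::cstar_algebra \<Rightarrow> 'a set" where
  "corner p = {p * a * p | a. True}"

text \<open>For a projection \<open>p\<close>, the unit of \<open>corner p\<close> is \<open>p\<close>.\<close>

definition corner_unitary_group :: "'a::cstar_algebra \<Rightarrow> 'a monoid" where
  "corner_unitary_group p =
     \<lparr>carrier = {u \<in> corner p. u\<^sup>\<star> * u = p \<and> u * u\<^sup>\<star> = p}, mult = (*), one = p\<rparr>"


section \<open>Hilbert modules\<close>

text \<open>
  The Banach norm of the type \<open>'x\<close> is required to be the one induced by the inner product;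
  completeness is then part of \<^class>\<open>complex_banach\<close>, and definiteness of the
  inner product follows from definiteness of the norm.
\<close>

locale hilbert_module =
  fixes act :: "'x::complex_banach \<Rightarrow> 'a::cstar_algebra \<Rightarrow> 'x"
    and ip :: "'x \<Rightarrow> 'x \<Rightarrow> 'a"
  assumes act_add_left: "act (x + y) a = act x a + act y a"
    and act_add_right: "act x (a + b) = act x a + act x b"
    and act_act: "act (act x a) b = act x (a * b)"
    and act_scaleC_left: "act (c *\<^sub>C x) a = c *\<^sub>C act x a"
    and act_scaleC_right: "act x (c *\<^sub>C a) = c *\<^sub>C act x a"
    and ip_add_right: "ip x (y + z) = ip x y + ip x z"
    and ip_scaleC_right: "ip x (c *\<^sub>C y) = c *\<^sub>C ip x y"
    and ip_act_right: "ip x (act y a) = ip x y * a"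
    and ip_star: "(ip x y)\<^sup>\<star> = ip y x"
    and ip_positive: "positive (ip x x)"
    and norm_eq_sqrt_ip: "norm x = sqrt (norm (ip x x))"

definition full_module :: "('x \<Rightarrow> 'x \<Rightarrow> 'a::cstar_algebra) \<Rightarrow> bool" where
  "full_module ip \<longleftrightarrow> closure (module.span scaleC {ip x y | x y. True}) = UNIV"

definition ip_sphere :: "('x \<Rightarrow> 'x \<Rightarrow> 'a::cstar_algebra) \<Rightarrow> 'a \<Rightarrow> 'x set" where
  "ip_sphere ip p = {x. ip x x = p}"

text \<open>
  A map of \<open>'x\<close> that has an adjoint is automatically bounded and linear over both the complex
  numbers and \<open>'a\<close>, and so is its adjoint. Hence the adjointable operators form a subset of
  the type of bounded real-linear maps, whose norm is the operator norm.
\<close>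

definition is_adjoint ::
    "('x \<Rightarrow> 'x \<Rightarrow> 'a::cstar_algebra) \<Rightarrow> ('x::complex_banach \<Rightarrow>\<^sub>L 'x) \<Rightarrow> ('x \<Rightarrow>\<^sub>L 'x) \<Rightarrow> bool" where
  "is_adjoint ip T S \<longleftrightarrow> (\<forall>x y. ip (blinfun_apply T x) y = ip x (blinfun_apply S y))"

definition adjointable ::
    "('x \<Rightarrow> 'x \<Rightarrow> 'a::cstar_algebra) \<Rightarrow> ('x::complex_banach \<Rightarrow>\<^sub>L 'x) set" where
  "adjointable ip = {T. \<exists>S. is_adjoint ip T S}"

definition op_projection ::
    "('x \<Rightarrow> 'x \<Rightarrow> 'a::cstar_algebra) \<Rightarrow> ('x::complex_banach \<Rightarrow>\<^sub>L 'x) \<Rightarrow> bool" where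
  "op_projection ip P \<longleftrightarrow> P \<in> adjointable ip \<and> is_adjoint ip P P \<and> P o\<^sub>L P = P"

definition murray_von_neumann ::
    "('x \<Rightarrow> 'x \<Rightarrow> 'a::cstar_algebra) \<Rightarrow> ('x::complex_banach \<Rightarrow>\<^sub>L 'x) \<Rightarrow> ('x \<Rightarrow>\<^sub>L 'x) \<Rightarrow> bool" where
  "murray_von_neumann ip P Q \<longleftrightarrow>
     (\<exists>V \<in> adjointable ip. \<exists>W \<in> adjointable ip. is_adjoint ip V W \<and> W o\<^sub>L V = P \<and> V o\<^sub>L W = Q)"

definition theta ::
    "('x::complex_banach \<Rightarrow> 'a::cstar_algebra \<Rightarrow> 'x) \<Rightarrow> ('x \<Rightarrow> 'x \<Rightarrow> 'a) \<Rightarrow> 'x \<Rightarrow> 'x \<Rightarrow> 'x \<Rightarrow>\<^sub>L 'x" where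
  "theta act ip x y = Blinfun (\<lambda>z. act x (ip y z))"

definition mvn_class ::
    "('x::complex_banach \<Rightarrow> 'a::cstar_algebra \<Rightarrow> 'x) \<Rightarrow> ('x \<Rightarrow> 'x \<Rightarrow> 'a) \<Rightarrow> 'x \<Rightarrow> ('x \<Rightarrow>\<^sub>L 'x) set" where
  "mvn_class act ip x0 = {P. op_projection ip P \<and> murray_von_neumann ip P (theta act ip x0 x0)}"

text \<open>
  The function in the definition of \<^const>\<open>theta\<close> is indeed bounded linear.
  Polarization bounds the inner product by \<open>4 * norm x * norm y\<close>, which is enough here.
\<close>

context hilbert_module
begin

lemma ip_add_left: "ip (x + y) z = ip x z + ip y z"
  by (metis ip_add_right ip_star star_add)

lemma ip_scaleC_left: "ip (c *\<^sub>C x) y = cnj c *\<^sub>C ip x y"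
  by (metis ip_scaleC_right ip_star star_scaleC)

lemma ip_scaleR_right: "ip x (r *\<^sub>R y) = r *\<^sub>R ip x y"
  by (metis ip_scaleC_right scaleC_of_real)

lemma ip_scaleR_left: "ip (r *\<^sub>R x) y = r *\<^sub>R ip x y"
  by (metis ip_scaleC_left scaleC_of_real complex_cnj_complex_of_real)

lemma norm_ip_self: "norm (ip x x) = (norm x)\<^sup>2"
  using norm_eq_sqrt_ip[of x] by simp

lemma norm_act_le: "norm (act x a) \<le> norm x * norm a"
proof -
  have "ip (act x a) (act x a) = a\<^sup>\<star> * ip x x * a"
    by (metis ip_act_right ip_star star_mult)
  moreover have "norm (a\<^sup>\<star>) \<le> norm a"
  proof (cases "norm (a\<^sup>\<star>) = 0")
    case False
    have "(norm (a\<^sup>\<star>))\<^sup>2 \<le> norm a * norm (a\<^sup>\<star>)"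
      using cstar_identity[of "a\<^sup>\<star>"] norm_mult_ineq[of a "a\<^sup>\<star>"] by (simp add: star_star)
    then show ?thesis using False by (simp add: power2_eq_square)
  qed simp
  moreover have "norm (a\<^sup>\<star> * ip x x * a) \<le> norm (a\<^sup>\<star>) * norm (ip x x) * norm a"
    by (rule order_trans[OF norm_mult_ineq mult_right_mono[OF norm_mult_ineq norm_ge_zero]])
  moreover have "norm (a\<^sup>\<star>) * norm (ip x x) * norm a \<le> norm a * norm (ip x x) * norm a"
    using calculation(2) by (intro mult_right_mono) simp_all
  ultimately have "(norm (act x a))\<^sup>2 \<le> norm a * (norm x)\<^sup>2 * norm a"
    using norm_ip_self[of "act x a"] norm_ip_self[of x] by simp
  also have "\<dots> = (norm x * norm a)\<^sup>2"
    by (simp add: power2_eq_square)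
  finally show ?thesis
    by (rule power2_le_imp_le) simp
qed

lemma norm_ip_le_unit:
  assumes "norm x = 1" "norm y = 1"
  shows "norm (ip x y) \<le> 4"
proof -
  have polar: "norm (ip u v + ip v u) \<le> 4" if "norm u = 1" "norm v = 1" for u v
  proof -
    have eq: "(ip u v + ip v u) + (ip u v + ip v u)
        = ip (u + v) (u + v) - ip (u + (-1) *\<^sub>R v) (u + (-1) *\<^sub>R v)"
      by (simp only: ip_add_left ip_add_right ip_scaleR_left ip_scaleR_right) simp
    have b: "norm (ip (u + w) (u + w)) \<le> 4" if "norm w = 1" for w
    proof -
      have "norm (u + w) \<le> 2"
        using norm_triangle_ineq[of u w] that \<open>norm u = 1\<close> by simp
      then show ?thesis
        using power_mono[of "norm (u + w)" 2 2] by (simp add: norm_ip_self)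
    qed
    have "norm ((ip u v + ip v u) + (ip u v + ip v u)) \<le> 4 + 4"
      unfolding eq by (rule order_trans[OF norm_triangle_ineq4 add_mono[OF b b]]) (use that in simp_all)
    moreover have "(ip u v + ip v u) + (ip u v + ip v u) = 2 *\<^sub>R (ip u v + ip v u)"
      by (simp add: scaleR_2)
    ultimately show ?thesis by simp
  qed
  define s where "s = ip x y + ip y x"
  define t where "t = ip x (\<i> *\<^sub>C y) + ip (\<i> *\<^sub>C y) x"
  have "norm s \<le> 4" "norm t \<le> 4"
    unfolding s_def t_def by (intro polar; simp add: assms norm_scaleC)+
  have one: "1 *\<^sub>C a = a" for a :: 'a
    using scaleC_of_real[of 1 a] by simp
  have "(-\<i>) *\<^sub>C t = ip x y + (-1) *\<^sub>C ip y x"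
    by (simp add: t_def ip_scaleC_left ip_scaleC_right scaleC_add_right scaleC_scaleC one)
  moreover have "(-1) *\<^sub>C a = - a" for a :: 'a
    using scaleC_of_real[of "-1" a] by simp
  ultimately have "s + (-\<i>) *\<^sub>C t = 2 *\<^sub>R ip x y"
    by (simp add: s_def scaleR_2)
  moreover have "norm (s + (-\<i>) *\<^sub>C t) \<le> 8"
    using norm_triangle_ineq[of s "(-\<i>) *\<^sub>C t"] \<open>norm s \<le> 4\<close> \<open>norm t \<le> 4\<close>
    by (simp add: norm_scaleC)
  ultimately show ?thesis by simp
qed

lemma norm_ip_le: "norm (ip x y) \<le> 4 * norm x * norm y"
proof (cases "x = 0 \<or> y = 0")
  case True
  then show ?thesis
    using ip_scaleR_left[of 0 0 y] ip_scaleR_right[of x 0 0] by auto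
next
  case False
  have "norm (ip ((1 / norm x) *\<^sub>R x) ((1 / norm y) *\<^sub>R y)) \<le> 4"
    by (rule norm_ip_le_unit) (use False in simp_all)
  then show ?thesis
    using False by (simp add: ip_scaleR_left ip_scaleR_right field_simps)
qed

lemma theta_apply: "blinfun_apply (theta act ip x y) z = act x (ip y z)"
proof -
  have "bounded_linear (\<lambda>z. act x (ip y z))"
  proof (rule bounded_linear_intro)
    show "act x (ip y (u + v)) = act x (ip y u) + act x (ip y v)" for u v
      by (simp add: ip_add_right act_add_right)
    show "act x (ip y (r *\<^sub>R u)) = r *\<^sub>R act x (ip y u)" for r u
      by (metis ip_scaleR_right act_scaleC_right scaleC_of_real)
    show "norm (act x (ip y u)) \<le> norm u * (norm x * (4 * norm y))" for u
      using norm_act_le[of x "ip y u"] mult_left_mono[OF norm_ip_le[of y u] norm_ge_zero[of x]]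
      by (simp add: mult_ac)
  qed
  then show ?thesis
    by (simp add: theta_def bounded_linear_Blinfun_apply)
qed

end


section \<open>Topological principal bundles\<close>

locale topological_group = group G for G :: "'g monoid" (structure) +
  fixes T :: "'g topology"
  assumes topspace_eq: "topspace T = carrier G"
    and continuous_mult: "continuous_map (prod_topology T T) T (\<lambda>(g, h). g \<otimes> h)"
    and continuous_inv: "continuous_map T T (\<lambda>g. inv g)"

text \<open>
  \<open>E\<close> is the total space, \<open>B\<close> the base, \<open>R\<close> the right action of the structure group \<open>G\<close>
  and \<open>\<pi>\<close> the bundle projection.
\<close>

locale principal_bundle = topological_group G T for G :: "'g monoid" (structure) and T +
  fixes E :: "'e topology" and B :: "'b topology"
    and R :: "'e \<Rightarrow> 'g \<Rightarrow> 'e" and \<pi> :: "'e \<Rightarrow> 'b"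
  assumes continuous_action: "continuous_map (prod_topology E T) E (\<lambda>(e, g). R e g)"
    and action_one: "e \<in> topspace E \<Longrightarrow> R e \<one> = e"
    and action_mult: "\<lbrakk>e \<in> topspace E; g \<in> carrier G; h \<in> carrier G\<rbrakk> \<Longrightarrow> R (R e g) h = R e (g \<otimes> h)"
    and free: "\<lbrakk>e \<in> topspace E; g \<in> carrier G; R e g = e\<rbrakk> \<Longrightarrow> g = \<one>"
    and continuous_projection: "continuous_map E B \<pi>"
    and surjective: "\<pi> ` topspace E = topspace B"
    and fibres_are_orbits: "\<lbrakk>e \<in> topspace E; e' \<in> topspace E\<rbrakk> \<Longrightarrow>
          \<pi> e = \<pi> e' \<longleftrightarrow> (\<exists>g \<in> carrier G. e' = R e g)"
    and locally_trivial: "b \<in> topspace B \<Longrightarrow>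
          \<exists>U \<phi>. openin B U \<and> b \<in> U \<and>
            homeomorphic_map (prod_topology (subtopology B U) T)
              (subtopology E {e \<in> topspace E. \<pi> e \<in> U}) \<phi> \<and>
            (\<forall>c \<in> U. \<forall>g \<in> carrier G. \<pi> (\<phi> (c, g)) = c) \<and>
            (\<forall>c \<in> U. \<forall>g \<in> carrier G. \<forall>h \<in> carrier G. \<phi> (c, g \<otimes> h) = R (\<phi> (c, g)) h)"

end

(*
  A projection P close to theta e e with P = theta y y determines y up to a unitary of p A p, so the
  point is to choose y continuously in P. The vector P e satisfies <P e, P e> = <e, P e>, which is
  close to p; multiplying P e on the right by the inverse square root c of this element of p A p
  gives a vector s P with <s P, s P> = p. It has the form y v with v isometric in p A p, and v is
  unitary because <y, e> <e, y> is close to p, so theta (s P) (s P) = P. Then (P, u) |-> (s P) u is a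
  local trivialization with inverse x |-> (theta x x, <s (theta x x), x>). The inverse square root
  comes from Banach's fixed point theorem, so no functional calculus is needed.
*)

theory Submission
  imports Defs
begin

section \<open>The corner of a projection\<close>

text \<open>The C*-identity for \<open>a\<^sup>\<star>\<close> bounds the square of its norm by
  \<open>norm a * norm (a\<^sup>\<star>)\<close>; the nonzero factor is then cancelled. This makes
  \<open>star\<close> bounded, hence continuous.\<close>

lemma norm_star_le: "norm (a\<^sup>\<star>) \<le> norm (a::'a::cstar_algebra)"
proof (cases "norm (a\<^sup>\<star>) = 0")
  case False
  have "(norm (a\<^sup>\<star>))\<^sup>2 \<le> norm a * norm (a\<^sup>\<star>)"
    using cstar_identity[of "a\<^sup>\<star>"] norm_mult_ineq[of a "a\<^sup>\<star>"] by (simp add: star_star)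
  then show ?thesis using False by (simp add: power2_eq_square)
qed simp

lemma star_scaleR: "(r *\<^sub>R a)\<^sup>\<star> = r *\<^sub>R (a::'a::cstar_algebra)\<^sup>\<star>"
  by (metis star_scaleC scaleC_of_real complex_cnj_complex_of_real)

lemma bounded_linear_star: "bounded_linear (star :: 'a::cstar_algebra \<Rightarrow> 'a)"
  by (rule bounded_linear_intro[of _ 1]) (simp_all add: star_add star_scaleR norm_star_le)

lemmas star_diff = linear_diff[OF bounded_linear.linear[OF bounded_linear_star]]
  and star_zero = linear_0[OF bounded_linear.linear[OF bounded_linear_star]]
  and continuous_on_star = bounded_linear.continuous_on[OF bounded_linear_star]

lemma norm_projection_le_1:
  assumes "projection (p::'a::cstar_algebra)"
  shows "norm p \<le> 1"
proof (cases "norm p = 0")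
  case False
  have "norm p * norm p = norm p"
    using cstar_identity[of p] assms by (simp add: projection_def power2_eq_square)
  then show ?thesis using False by simp
qed simp

text \<open>Trades the existential description of the corner for two equations, which serve as
  rewrite rules and are closed conditions.\<close>

lemma corner_iff:
  assumes "projection p"
  shows "a \<in> corner p \<longleftrightarrow> p * a = a \<and> a * p = a"
proof
  assume "a \<in> corner p"
  then obtain b where "a = p * b * p" by (auto simp: corner_def)
  with assms show "p * a = a \<and> a * p = a"
    by (metis projection_def mult.assoc)
next
  assume "p * a = a \<and> a * p = a"
  then show "a \<in> corner p" unfolding corner_def by (metis (mono_tags) mem_Collect_eq)
qed

section \<open>The unitary group of a corner as a topological group\<close>

lemma unitary_iff:
  assumes "projection p"
  shows "u \<in> carrier (corner_unitary_group p) \<longleftrightarrow>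
    p * u = u \<and> u * p = u \<and> u\<^sup>\<star> * u = p \<and> u * u\<^sup>\<star> = p"
  using corner_iff[OF assms] by (auto simp: corner_unitary_group_def)

lemma star_unitary:
  assumes "projection p" "u \<in> carrier (corner_unitary_group p)"
  shows "u\<^sup>\<star> \<in> carrier (corner_unitary_group p)"
  using assms by (metis unitary_iff projection_def star_mult star_star)

lemma group_corner_unitary:
  assumes p: "projection p"
  shows "group (corner_unitary_group p)"
proof (rule groupI)
  fix u v assume "u \<in> carrier (corner_unitary_group p)" "v \<in> carrier (corner_unitary_group p)"
  then have u: "p * u = u" "u * p = u" "u\<^sup>\<star> * u = p" "u * u\<^sup>\<star> = p"
    and v: "p * v = v" "v * p = v" "v\<^sup>\<star> * v = p" "v * v\<^sup>\<star> = p"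
    using unitary_iff[OF p] by auto
  have "(u * v)\<^sup>\<star> * (u * v) = v\<^sup>\<star> * (u\<^sup>\<star> * u) * v" "(u * v) * (u * v)\<^sup>\<star> = u * (v * v\<^sup>\<star>) * u\<^sup>\<star>"
    by (simp_all add: star_mult mult.assoc)
  moreover have "p * (u * v) = u * v" "u * v * p = u * v"
    using u v by (metis mult.assoc)+
  ultimately have "u * v \<in> carrier (corner_unitary_group p)"
    using u v by (simp add: unitary_iff[OF p] mult.assoc)
  then show "u \<otimes>\<^bsub>corner_unitary_group p\<^esub> v \<in> carrier (corner_unitary_group p)"
    by (simp add: corner_unitary_group_def)
next
  show "\<one>\<^bsub>corner_unitary_group p\<^esub> \<in> carrier (corner_unitary_group p)"
    using p unitary_iff[OF p, of p] by (simp add: corner_unitary_group_def projection_def)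
next
  fix u assume u: "u \<in> carrier (corner_unitary_group p)"
  show "\<one>\<^bsub>corner_unitary_group p\<^esub> \<otimes>\<^bsub>corner_unitary_group p\<^esub> u = u"
    using u unitary_iff[OF p, of u] by (simp add: corner_unitary_group_def)
  show "\<exists>v\<in>carrier (corner_unitary_group p). v \<otimes>\<^bsub>corner_unitary_group p\<^esub> u = \<one>\<^bsub>corner_unitary_group p\<^esub>"
    by (rule bexI[OF _ star_unitary[OF p u]])
      (use u unitary_iff[OF p, of u] in \<open>simp add: corner_unitary_group_def\<close>)
qed (simp add: corner_unitary_group_def mult.assoc)

text \<open>Inversion thereby becomes a restriction of \<open>star\<close>, which gives its
  continuity.\<close>

lemma inv_corner_unitary:
  assumes p: "projection p" and u: "u \<in> carrier (corner_unitary_group p)"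
  shows "inv\<^bsub>corner_unitary_group p\<^esub> u = u\<^sup>\<star>"
  using group.inv_equality[OF group_corner_unitary[OF p] _ u star_unitary[OF p u]]
    u unitary_iff[OF p, of u] by (simp add: corner_unitary_group_def)

lemma topological_group_corner_unitary:
  fixes p :: "'a::cstar_algebra"
  assumes p: "projection p"
  shows "topological_group (corner_unitary_group p) (top_of_set (carrier (corner_unitary_group p)))"
proof -
  let ?G = "corner_unitary_group p"
  interpret group ?G by (rule group_corner_unitary[OF p])
  have m: "(\<otimes>\<^bsub>?G\<^esub>) = (*)" by (simp add: corner_unitary_group_def)
  have cl: "u * v \<in> carrier ?G" if "u \<in> carrier ?G" "v \<in> carrier ?G" for u v
    using m_closed[OF that] by (simp add: m)
  have c: "continuous_on (carrier ?G \<times> carrier ?G) (\<lambda>(g, h). g * h)"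
    unfolding case_prod_beta by (intro continuous_intros)
  have i: "continuous_on (carrier ?G) (\<lambda>g. inv\<^bsub>?G\<^esub> g)"
    by (rule continuous_on_eq[OF continuous_on_star[OF continuous_on_id]])
      (simp add: inv_corner_unitary[OF p])
  show ?thesis
    by unfold_locales (use c i cl in \<open>auto simp: prod_topology_subtopology_eu m\<close>)
qed

section \<open>Inverse square roots near the unit of a corner\<close>

text \<open>With \<open>c = p + w\<close>, the equation \<open>c * (p - h) * c = p\<close> in the corner says that \<open>w\<close> is a
  fixed point of this map.\<close>

definition isqrt_step :: "'a::cstar_algebra \<Rightarrow> 'a \<Rightarrow> 'a" where
  "isqrt_step h w = (1/2) *\<^sub>R (h - w * w + w * h + h * w + w * (h * w))"

lemma norm_mult_le_bounds:
  fixes a b :: "'a::real_normed_algebra"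
  assumes "norm a \<le> r" "norm b \<le> s"
  shows "norm (a * b) \<le> r * s"
  by (rule order_trans[OF norm_mult_ineq mult_mono[OF assms]])
    (use order_trans[OF norm_ge_zero assms(1)] in auto)

text \<open>One estimate serves three purposes: \<open>h = k\<close> gives contraction by 1/2,
  \<open>k = 0\<close> and \<open>v = 0\<close> give invariance of the ball of radius 1/4, and
  comparing fixed points for \<open>h\<close> and \<open>k\<close> gives Lipschitz dependence on the
  parameter.\<close>

lemma isqrt_step_diff:
  fixes h k v w :: "'a::cstar_algebra"
  assumes h: "norm h \<le> 1/8" and k: "norm k \<le> 1/8" and w: "norm w \<le> 1/4" and v: "norm v \<le> 1/4"
  shows "norm (isqrt_step h w - isqrt_step k v) \<le> norm (h - k) + 1/2 * norm (w - v)"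
proof -
  define d e where "d = norm (w - v)" and "e = norm (h - k)"
  have d: "norm (w - v) \<le> d" and e: "norm (h - k) \<le> e" and pos: "0 \<le> d" "0 \<le> e"
    by (simp_all add: d_def e_def)
  \<comment> \<open>The products are telescoped by changing one factor at a time, so every summand
    contains exactly one difference.\<close>
  have "isqrt_step h w - isqrt_step k v = (1/2) *\<^sub>R ((h - k) - w * (w - v) - (w - v) * v
      + (w - v) * h + v * (h - k) + h * (w - v) + (h - k) * v
      + (w - v) * (h * w) + v * ((h - k) * w) + v * (k * (w - v)))"
    by (simp add: isqrt_step_def algebra_simps)
  then have "norm (isqrt_step h w - isqrt_step k v) = 1/2 * norm ((h - k) - w * (w - v) - (w - v) * v
      + (w - v) * h + v * (h - k) + h * (w - v) + (h - k) * v
      + (w - v) * (h * w) + v * ((h - k) * w) + v * (k * (w - v)))"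
    by simp
  also have "\<dots> \<le> 1/2 * (e + 1/4 * d + d * (1/4)
      + d * (1/8) + 1/4 * e + 1/8 * d + e * (1/4)
      + d * (1/8 * (1/4)) + 1/4 * (e * (1/4)) + 1/4 * (1/8 * d))"
    by (intro mult_left_mono norm_triangle_mono norm_triangle_le_diff
        norm_mult_le_bounds d e h k v w order_trans[OF norm_triangle_ineq4 add_mono]) simp
  \<comment> \<open>With the factor 1/2 included, the coefficients of \<open>e\<close> and
    \<open>d\<close> are 25/32 and 13/32.\<close>
  also have "\<dots> \<le> e + 1/2 * d" using pos by simp
  finally show ?thesis by (simp add: d_def e_def)
qed

lemma corner_inverse_sqrt:
  fixes p :: "'a::cstar_algebra"
  assumes p: "projection p"
  defines "H \<equiv> {h \<in> corner p. h\<^sup>\<star> = h \<and> norm h \<le> 1/8}"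
  obtains c where "continuous_on H c" "\<And>h. h \<in> H \<Longrightarrow> c h \<in> corner p"
    "\<And>h. h \<in> H \<Longrightarrow> (c h)\<^sup>\<star> = c h" "\<And>h. h \<in> H \<Longrightarrow> c h * (p - h) * c h = p"
proof -
  \<comment> \<open>The corner relations and self-adjointness are closed conditions; building them
    into the complete set passes them on to the fixed point.\<close>
  define S where "S = {w. p * w = w \<and> w * p = w \<and> w\<^sup>\<star> = w \<and> norm w \<le> 1/4}"
  have "closed S"
    unfolding S_def
    by (intro closed_Collect_conj closed_Collect_eq closed_Collect_le continuous_intros continuous_on_star)
  then have S: "complete S" "S \<noteq> {}"
    by (auto simp: complete_eq_closed S_def star_zero intro!: exI[of _ 0])
  have Hi: "p * h = h" "h * p = h" "h\<^sup>\<star> = h" "norm h \<le> 1/8" if "h \<in> H" for h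
    using that corner_iff[OF p] by (auto simp: H_def)
  have "\<exists>!w. w \<in> S \<and> isqrt_step h w = w" if "h \<in> H" for h
  proof (rule Banach_fix[OF S, of "1/2"])
    note h = Hi[OF that]
    show "isqrt_step h ` S \<subseteq> S"
    proof (clarify)
      fix w assume "w \<in> S"
      then have w: "p * w = w" "w * p = w" "w\<^sup>\<star> = w" "norm w \<le> 1/4" by (auto simp: S_def)
      have a: "p * (h * b) = h * b" "p * (w * b) = w * b" for b
        using h w by (metis mult.assoc)+
      \<comment> \<open>Comparison with \<open>isqrt_step 0 0 = 0\<close> gives the bound 1/8 + 1/2
        * 1/4.\<close>
      have "norm (isqrt_step h w) \<le> 1/4"
        using isqrt_step_diff[of h 0 w 0] h w by (simp add: isqrt_step_def)
      then show "isqrt_step h w \<in> S"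
        using h w a by (simp add: S_def isqrt_step_def star_add star_diff star_mult star_scaleR
            distrib_left distrib_right right_diff_distrib left_diff_distrib mult.assoc)
    qed
    show "dist (isqrt_step h w) (isqrt_step h v) \<le> 1/2 * dist w v" if "w \<in> S" "v \<in> S" for w v
      using isqrt_step_diff[of h h w v] h that by (simp add: S_def dist_norm)
  qed auto
  then obtain f where f: "\<And>h. h \<in> H \<Longrightarrow> f h \<in> S" "\<And>h. h \<in> H \<Longrightarrow> isqrt_step h (f h) = f h"
    by metis
  \<comment> \<open>Both sides of the estimate contain the distance of the fixed points, on the
    right with factor 1/2; absorbing it leaves the constant 2.\<close>
  have "norm (f h - f k) \<le> 2 * norm (h - k)" if "h \<in> H" "k \<in> H" for h k
    using isqrt_step_diff[of h k "f h" "f k"] f[OF that(1)] f[OF that(2)] Hi[OF that(1)] Hi[OF that(2)]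
    by (simp add: S_def)
  then have "2-lipschitz_on H f" by (intro lipschitz_onI) (auto simp: dist_norm)
  then have "continuous_on H f" by (rule lipschitz_on_continuous_on)
  then have cont: "continuous_on H (\<lambda>h. p + f h)" by (intro continuous_intros)
  show ?thesis
  proof (rule that[OF cont])
    fix h assume hH: "h \<in> H"
    note h = Hi[OF hH]
    from f(1)[OF hH] have w: "p * f h = f h" "f h * p = f h" "(f h)\<^sup>\<star> = f h" by (auto simp: S_def)
    from p have pp: "p * p = p" "p\<^sup>\<star> = p" by (auto simp: projection_def)
    show "p + f h \<in> corner p" using w pp by (simp add: corner_iff[OF p] algebra_simps)
    show "(p + f h)\<^sup>\<star> = p + f h" using w pp by (simp add: star_add)
    have a: "p * (h * b) = h * b" "p * (f h * b) = f h * b" for b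
      using h w by (metis mult.assoc)+
    \<comment> \<open>Twice the fixed-point equation: exactly the relation needed when
      \<open>(p + f h) * (p - h) * (p + f h)\<close> is expanded.\<close>
    have "2 *\<^sub>R f h = h - f h * f h + f h * h + h * f h + f h * (h * f h)"
      by (subst f(2)[OF hH, symmetric]) (simp add: isqrt_step_def)
    then show "(p + f h) * (p - h) * (p + f h) = p"
      using h w pp a by (simp add: scaleR_2 algebra_simps)
  qed
qed

section \<open>The bundle of partial isometries\<close>

context hilbert_module
begin

section \<open>Joint continuity of the module operations, and adjoints\<close>

lemma ip_act_left: "ip (act x a) y = a\<^sup>\<star> * ip x y"
  by (metis ip_act_right ip_star star_mult)

lemma act_scaleR_left: "act (r *\<^sub>R x) a = r *\<^sub>R act x a"
  by (metis act_scaleC_left scaleC_of_real)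

lemma act_scaleR_right: "act x (r *\<^sub>R a) = r *\<^sub>R act x a"
  by (metis act_scaleC_right scaleC_of_real)

lemma bounded_bilinear_act: "bounded_bilinear act"
  by standard (use norm_act_le in \<open>auto simp: act_add_left act_add_right act_scaleR_left act_scaleR_right
      intro!: exI[of _ 1]\<close>)

text \<open>Bilinearity is over the reals, so the conjugate-linear first argument causes no trouble
  and joint continuity follows.\<close>

lemma bounded_bilinear_ip: "bounded_bilinear ip"
  by standard (use norm_ip_le in \<open>auto simp: ip_add_left ip_add_right ip_scaleR_left ip_scaleR_right mult_ac
      intro!: exI[of _ 4]\<close>)

lemma bounded_bilinear_theta: "bounded_bilinear (theta act ip)"
proof
  show "\<exists>K. \<forall>x y. norm (theta act ip x y) \<le> norm x * norm y * K"
  proof (intro exI[of _ 4] allI norm_blinfun_bound)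
    fix x y z
    show "norm (blinfun_apply (theta act ip x y) z) \<le> norm x * norm y * 4 * norm z"
      using norm_act_le[of x "ip y z"] mult_left_mono[OF norm_ip_le[of y z] norm_ge_zero[of x]]
      by (simp add: theta_apply mult_ac)
  qed simp
qed (auto intro!: blinfun_eqI simp: theta_apply blinfun.add_left blinfun.scaleR_left
      ip_add_left ip_scaleR_left act_add_left act_add_right act_scaleR_left act_scaleR_right)

lemmas ip_diff_left = bounded_bilinear.diff_left[OF bounded_bilinear_ip]
  and ip_diff_right = bounded_bilinear.diff_right[OF bounded_bilinear_ip]
  and continuous_on_act = bounded_bilinear.continuous_on[OF bounded_bilinear_act]
  and continuous_on_ip = bounded_bilinear.continuous_on[OF bounded_bilinear_ip]
  and continuous_on_theta = bounded_bilinear.continuous_on[OF bounded_bilinear_theta]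

lemma ip_self_eq_0_iff: "ip x x = 0 \<longleftrightarrow> x = 0"
  using norm_ip_self[of x] by (metis norm_eq_zero power2_eq_square mult_eq_0_iff)

lemma ip_ext:
  assumes "\<And>z. ip x z = ip y z"
  shows "x = y"
  using ip_self_eq_0_iff[of "x - y"] assms by (simp add: ip_diff_left)

text \<open>Pairing with an arbitrary vector moves \<open>V\<close> across as \<open>W\<close>,
  while \<open>a\<close> comes out as a left factor \<open>a\<^sup>\<star>\<close>.\<close>

lemma is_adjoint_act:
  assumes "is_adjoint ip V W"
  shows "blinfun_apply V (act x a) = act (blinfun_apply V x) a"
  using assms by (intro ip_ext) (simp add: is_adjoint_def ip_act_left)

lemma is_adjoint_sym:
  assumes "is_adjoint ip V W"
  shows "is_adjoint ip W V"
  using assms unfolding is_adjoint_def by (metis ip_star)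

lemma is_adjoint_theta: "is_adjoint ip (theta act ip x y) (theta act ip y x)"
  by (simp add: is_adjoint_def theta_apply ip_act_left ip_act_right ip_star)

lemma theta_adjointable: "theta act ip x y \<in> adjointable ip"
  using is_adjoint_theta by (auto simp: adjointable_def)

section \<open>Rank-one partial isometries and the description of the base\<close>

lemma sphere_act_unit:
  assumes "projection p" "x \<in> ip_sphere ip p"
  shows "act x p = x"
proof -
  \<comment> \<open>All four inner products in the expansion equal \<open>p\<close>, and they cancel
    in pairs.\<close>
  have "ip (act x p - x) (act x p - x) = 0"
    using assms by (simp add: ip_diff_left ip_diff_right ip_act_left ip_act_right ip_sphere_def projection_def)
  then show ?thesis by (simp add: ip_self_eq_0_iff)
qed

text \<open>Since \<open>ip y y = p\<close> acts as the identity on \<open>x\<close>, these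
  operators multiply like matrix units.\<close>

lemma theta_compose:
  assumes "projection p" "y \<in> ip_sphere ip p" "x \<in> ip_sphere ip p"
  shows "theta act ip x y o\<^sub>L theta act ip y z = theta act ip x z"
  using assms sphere_act_unit[OF assms(1,3)]
  by (intro blinfun_eqI) (simp add: theta_apply ip_act_right ip_sphere_def flip: act_act)

lemma mvn_class_eq_image_theta:
  assumes p: "projection p" and x0: "x0 \<in> ip_sphere ip p"
  shows "mvn_class act ip x0 = (\<lambda>x. theta act ip x x) ` ip_sphere ip p"
proof (intro equalityI subsetI)
  fix P assume "P \<in> mvn_class act ip x0"
  then obtain V W where P: "op_projection ip P" and VW: "is_adjoint ip V W"
    and WV: "W o\<^sub>L V = P" and VW_eq: "V o\<^sub>L W = theta act ip x0 x0"
    by (auto simp: mvn_class_def murray_von_neumann_def)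
  have adj: "ip (blinfun_apply W x) y = ip x (blinfun_apply V y)" for x y
    using is_adjoint_sym[OF VW] by (simp add: is_adjoint_def)
  \<comment> \<open>The partial isometry \<open>W\<close> carries \<open>x0\<close> to a vector with
    \<open>theta x x z = W (x0 <x0, V z>) = W V W V z\<close>, which is \<open>P z\<close> because
    \<open>P = W V\<close> is idempotent.\<close>
  define x where "x = blinfun_apply W x0"
  have VWx: "blinfun_apply V (blinfun_apply W z) = act x0 (ip x0 z)" for z
    by (metis VW_eq blinfun_apply_blinfun_compose theta_apply)
  have PP: "blinfun_apply W (blinfun_apply V (blinfun_apply W (blinfun_apply V z))) = blinfun_apply P z" for z
    using P WV unfolding op_projection_def by (metis blinfun_apply_blinfun_compose)
  have "ip x x = p"
    using x0 p by (simp add: x_def adj VWx ip_act_right ip_sphere_def projection_def)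
  moreover have "theta act ip x x = P"
  proof (rule blinfun_eqI)
    fix z
    show "blinfun_apply (theta act ip x x) z = blinfun_apply P z"
      by (simp add: theta_apply x_def adj VWx PP flip: is_adjoint_act[OF is_adjoint_sym[OF VW]])
        (simp add: PP flip: VWx)
  qed
  ultimately show "P \<in> (\<lambda>x. theta act ip x x) ` ip_sphere ip p" by (auto simp: ip_sphere_def)
next
  fix P assume "P \<in> (\<lambda>x. theta act ip x x) ` ip_sphere ip p"
  then obtain x where x: "x \<in> ip_sphere ip p" and P: "P = theta act ip x x" by auto
  have "op_projection ip P"
    using theta_compose[OF p x x] is_adjoint_theta theta_adjointable by (simp add: op_projection_def P)
  \<comment> \<open>The equivalence is implemented by \<open>theta act ip x0 x\<close> and its
    adjoint \<open>theta act ip x x0\<close>.\<close>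
  moreover have "murray_von_neumann ip P (theta act ip x0 x0)"
    unfolding murray_von_neumann_def P
    using theta_compose[OF p x x0] theta_compose[OF p x0 x] is_adjoint_theta theta_adjointable by blast
  ultimately show "P \<in> mvn_class act ip x0" by (simp add: mvn_class_def)
qed

section \<open>The fibres as orbits of the unitary group\<close>

lemma sphere_act_unitary:
  assumes p: "projection p" and x: "x \<in> ip_sphere ip p" and u: "u \<in> carrier (corner_unitary_group p)"
  shows "act x u \<in> ip_sphere ip p" "theta act ip (act x u) (act x u) = theta act ip x x"
proof -
  have u': "p * u = u" "u\<^sup>\<star> * u = p" "u * u\<^sup>\<star> = p" using unitary_iff[OF p] u by auto
  show "act x u \<in> ip_sphere ip p"
    using x u' by (simp add: ip_sphere_def ip_act_left ip_act_right mult.assoc)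
  show "theta act ip (act x u) (act x u) = theta act ip x x"
  proof (rule blinfun_eqI)
    fix z
    have "act (act x u) (ip (act x u) z) = act (act x (u * u\<^sup>\<star>)) (ip x z)"
      by (simp add: ip_act_left act_act mult.assoc)
    then show "blinfun_apply (theta act ip (act x u) (act x u)) z = blinfun_apply (theta act ip x x) z"
      using u' sphere_act_unit[OF p x] by (simp add: theta_apply)
  qed
qed

lemma ip_in_corner:
  assumes p: "projection p" and x: "x \<in> ip_sphere ip p" and y: "y \<in> ip_sphere ip p"
  shows "ip x y \<in> corner p"
  using sphere_act_unit[OF p x] sphere_act_unit[OF p y] p
  by (metis corner_iff[OF p] ip_act_left ip_act_right projection_def)

text \<open>Evaluating the common projection at \<open>y\<close> gives \<open>y = x <x, y>\<close>,
  and at \<open>x\<close> gives \<open>x = y <y, x>\<close>. Pairing these with \<open>y\<close> and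
  \<open>x\<close> turns them into the two unitarity relations.\<close>

lemma ip_unitary:
  assumes p: "projection p" and x: "x \<in> ip_sphere ip p" and y: "y \<in> ip_sphere ip p"
    and eq: "theta act ip x x = theta act ip y y"
  shows "ip x y \<in> carrier (corner_unitary_group p)" "act x (ip x y) = y"
proof -
  have yx: "act x (ip x z) = act y (ip y z)" for z
    by (metis eq theta_apply)
  show y': "act x (ip x y) = y"
    using yx[of y] y sphere_act_unit[OF p y] by (simp add: ip_sphere_def)
  have x': "act y (ip y x) = x"
    using yx[of x] x sphere_act_unit[OF p x] by (simp add: ip_sphere_def)
  have "(ip x y)\<^sup>\<star> * ip x y = p" "ip x y * (ip x y)\<^sup>\<star> = p"
    using x y ip_act_right[of y x "ip x y"] ip_act_right[of x y "ip y x"]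
    by (simp_all add: ip_star x' y' ip_sphere_def)
  then show "ip x y \<in> carrier (corner_unitary_group p)"
    using ip_in_corner[OF p x y] corner_iff[OF p] unitary_iff[OF p] by blast
qed

section \<open>Local sections and local trivializations\<close>

lemma norm_sphere_le_1:
  assumes "projection p" "x \<in> ip_sphere ip p"
  shows "norm x \<le> 1"
proof -
  have "(norm x)\<^sup>2 \<le> 1\<^sup>2"
    using norm_ip_self[of x] norm_projection_le_1[OF assms(1)] assms(2) by (simp add: ip_sphere_def)
  then show ?thesis by (rule power2_le_imp_le) simp
qed

text \<open>The 4 is inherited from \<open>norm_ip_le\<close>. It explains the radius 1/32 below:
  4/32 = 1/8 is the size allowed in \<open>corner_inverse_sqrt\<close>.\<close>

lemma norm_ip_apply_le:
  assumes "projection p" "x \<in> ip_sphere ip p"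
  shows "norm (ip x (blinfun_apply T x)) \<le> 4 * norm T"
proof -
  have x: "norm x \<le> 1" using norm_sphere_le_1[OF assms] .
  have T: "norm (blinfun_apply T x) \<le> norm T"
    using norm_blinfun[of T x] mult_left_mono[OF x norm_ge_zero[of T]] by simp
  have "norm (ip x (blinfun_apply T x)) \<le> 4 * norm x * norm (blinfun_apply T x)" by (rule norm_ip_le)
  also have "\<dots> \<le> 4 * 1 * norm T" by (intro mult_mono x T) auto
  finally show ?thesis by simp
qed

lemma local_section:
  assumes p: "projection p" and e: "e \<in> ip_sphere ip p"
  defines "U \<equiv> {P \<in> (\<lambda>x. theta act ip x x) ` ip_sphere ip p. dist P (theta act ip e e) < 1/32}"
  obtains s where "continuous_on U s"
    "\<And>P. P \<in> U \<Longrightarrow> s P \<in> ip_sphere ip p" "\<And>P. P \<in> U \<Longrightarrow> theta act ip (s P) (s P) = P"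
proof -
  define H where "H = {h \<in> corner p. h\<^sup>\<star> = h \<and> norm h \<le> 1/8}"
  obtain c where c: "continuous_on H c" "\<And>h. h \<in> H \<Longrightarrow> c h \<in> corner p"
    "\<And>h. h \<in> H \<Longrightarrow> (c h)\<^sup>\<star> = c h" "\<And>h. h \<in> H \<Longrightarrow> c h * (p - h) * c h = p"
    using corner_inverse_sqrt[OF p, folded H_def] by blast
  define h where "h P = p - ip e (blinfun_apply P e)" for P
  define s where "s P = act (blinfun_apply P e) (c (h P))" for P
  have ep: "act e p = e" "ip e e = p" using sphere_act_unit[OF p e] e by (auto simp: ip_sphere_def)
  have hP: "h P \<in> corner p" "(h P)\<^sup>\<star> = h P" "norm (h P) \<le> 1/8" if "P \<in> U" for P
  proof -
    from that obtain y where y: "y \<in> ip_sphere ip p" and P: "P = theta act ip y y" and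
      d: "dist P (theta act ip e e) < 1/32" by (auto simp: U_def)
    have g: "ip e y * p = ip e y" "p * ip e y = ip e y" "p * ip y e = ip y e" "ip y e * p = ip y e"
      using ip_in_corner[OF p e y] ip_in_corner[OF p y e] by (auto simp: corner_iff[OF p])
    have hy: "h P = p - ip e y * ip y e" by (simp add: h_def P theta_apply ip_act_right)
    have pp: "p * p = p" "p\<^sup>\<star> = p" using p by (auto simp: projection_def)
    have "p * (ip e y * ip y e) = ip e y * ip y e" using g by (metis mult.assoc)
    then show "h P \<in> corner p" using g pp by (simp add: corner_iff[OF p] hy algebra_simps)
    show "(h P)\<^sup>\<star> = h P" using pp by (simp add: hy star_diff star_mult ip_star)
    \<comment> \<open>As \<open>theta act ip e e\<close> fixes \<open>e\<close>, the defect
      \<open>h P\<close> is a matrix coefficient of a difference of two nearby projections.\<close>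
    have "h P = ip e (blinfun_apply (theta act ip e e - P) e)"
      by (simp add: h_def blinfun.diff_left theta_apply ip_diff_right ep)
    then show "norm (h P) \<le> 1/8"
      using norm_ip_apply_le[OF p e, of "theta act ip e e - P"] d by (simp add: dist_norm norm_minus_commute)
  qed
  have "continuous_on U h"
    unfolding h_def by (intro continuous_intros continuous_on_ip)
  then have "continuous_on U (\<lambda>P. c (h P))"
    by (rule continuous_on_compose2[OF c(1)]) (use hP in \<open>auto simp: H_def\<close>)
  then have cont: "continuous_on U s"
    unfolding s_def by (intro continuous_on_act continuous_intros)
  have sP: "s P \<in> ip_sphere ip p \<and> theta act ip (s P) (s P) = P" if PU: "P \<in> U" for P
  proof -
    from PU obtain y where y: "y \<in> ip_sphere ip p" and P: "P = theta act ip y y" and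
      d: "dist P (theta act ip e e) < 1/32" by (auto simp: U_def)
    \<comment> \<open>Here \<open>P e = y g\<close>, so multiplying by the inverse square root
      \<open>k\<close> gives \<open>s P = y v\<close>.\<close>
    define g where "g = ip y e"
    define k where "k = c (h P)"
    define v where "v = g * k"
    have yp: "act y p = y" "ip y y = p" using sphere_act_unit[OF p y] y by (auto simp: ip_sphere_def)
    have pp: "p * p = p" "p\<^sup>\<star> = p" using p by (auto simp: projection_def)
    have g: "p * g = g" "g * p = g" "g\<^sup>\<star> = ip e y" "p * g\<^sup>\<star> = g\<^sup>\<star>"
      using ip_in_corner[OF p y e] ip_in_corner[OF p e y] by (auto simp: corner_iff[OF p] g_def ip_star)
    have ha: "p - h P = g\<^sup>\<star> * g" by (simp add: h_def P theta_apply ip_act_right g_def ip_star)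
    have k: "p * k = k" "k * p = k" "k\<^sup>\<star> = k" "k * (g\<^sup>\<star> * g) * k = p"
      using c(2-4)[of "h P"] hP[OF PU] by (auto simp: H_def k_def corner_iff[OF p] ha)
    have sy: "s P = act y v" by (simp add: s_def P theta_apply act_act v_def g_def k_def)
    have pv: "p * v = v" "v * p = v" using g k by (metis v_def mult.assoc)+
    have vv: "v\<^sup>\<star> * v = p" using k by (simp add: v_def star_mult mult.assoc)
    \<comment> \<open>An isometry of the corner need not be unitary in general; \<open>q\<close> is
      the defect, and it has to be shown to vanish.\<close>
    define q where "q = p - v * v\<^sup>\<star>"
    have "q * v = 0" using pv vv by (simp add: q_def left_diff_distrib mult.assoc)
    \<comment> \<open>From \<open>q * v = q * g * k = 0\<close>, multiplied on the right by the
      remaining factors. The bracket equals \<open>p\<close>, so \<open>k\<close> disappears and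
      \<open>q * g = 0\<close>.\<close>
    then have "q * g * (k * (g\<^sup>\<star> * g) * k) = 0"
      by (simp add: v_def flip: mult.assoc)
    then have "q * g = 0" using g k by (simp add: mult.assoc)
    then have "q * (g * g\<^sup>\<star>) = 0" by (simp flip: mult.assoc)
    moreover have "q * p = q" using pp pv by (simp add: q_def left_diff_distrib mult.assoc) (metis pv pp star_mult)
    ultimately have "q = q * (p - g * g\<^sup>\<star>)" by (simp add: right_diff_distrib)
    \<comment> \<open>A fixed point of right multiplication by an element of norm below 1 must be
      zero.\<close>
    then have "norm q \<le> norm q * norm (p - g * g\<^sup>\<star>)" by (metis norm_mult_ineq)
    moreover have "norm (p - g * g\<^sup>\<star>) < 1"
    proof -
      have "p - g * g\<^sup>\<star> = ip y (blinfun_apply (P - theta act ip e e) y)"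
        by (simp add: blinfun.diff_left theta_apply ip_diff_right P yp ip_act_right g_def ip_star pp)
      then show ?thesis
        using norm_ip_apply_le[OF p y, of "P - theta act ip e e"] d by (simp add: dist_norm)
    qed
    ultimately have "q = 0"
      by (metis mult_less_cancel_left2 linorder_not_less norm_eq_zero norm_ge_zero order_le_less)
    then have "v * v\<^sup>\<star> = p" by (simp add: q_def)
    then have "v \<in> carrier (corner_unitary_group p)"
      unfolding unitary_iff[OF p] using pv vv by blast
    then show ?thesis using sphere_act_unitary[OF p y, of v] unfolding sy P[symmetric] by simp
  qed
  show ?thesis by (rule that[OF cont]) (use sP in auto)
qed

lemma local_trivialization:
  assumes p: "projection p" and e: "e \<in> ip_sphere ip p"
  defines "G \<equiv> carrier (corner_unitary_group p)" and "\<rho> \<equiv> \<lambda>x. theta act ip x x"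
  obtains U \<phi> where "openin (top_of_set (\<rho> ` ip_sphere ip p)) U" "\<rho> e \<in> U"
    "homeomorphic_map (top_of_set (U \<times> G)) (top_of_set {x \<in> ip_sphere ip p. \<rho> x \<in> U}) \<phi>"
    "\<And>P u. \<lbrakk>P \<in> U; u \<in> G\<rbrakk> \<Longrightarrow> \<rho> (\<phi> (P, u)) = P"
    "\<And>P u v. \<phi> (P, u * v) = act (\<phi> (P, u)) v"
proof -
  define U where "U = {P \<in> (\<lambda>x. theta act ip x x) ` ip_sphere ip p. dist P (theta act ip e e) < 1/32}"
  obtain s where s: "continuous_on U s" "\<And>P. P \<in> U \<Longrightarrow> s P \<in> ip_sphere ip p"
    "\<And>P. P \<in> U \<Longrightarrow> theta act ip (s P) (s P) = P"
    using local_section[OF p e, folded U_def] by blast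
  define \<phi> where "\<phi> = (\<lambda>(P, u). act (s P) u)"
  \<comment> \<open>The points \<open>s (\<rho> x)\<close> and \<open>x\<close> lie in the same
    fibre, so by \<open>ip_unitary\<close> the second coordinate is the unitary carrying the former
    to the latter.\<close>
  define \<psi> where "\<psi> x = (\<rho> x, ip (s (\<rho> x)) x)" for x
  have \<rho>\<phi>: "\<rho> (act (s P) u) = P" "act (s P) u \<in> ip_sphere ip p" if "P \<in> U" "u \<in> G" for P u
    using sphere_act_unitary[OF p s(2)[OF that(1)]] that s(3)[OF that(1)] by (auto simp: G_def \<rho>_def)
  have \<psi>: "ip (s (\<rho> x)) x \<in> G" "act (s (\<rho> x)) (ip (s (\<rho> x)) x) = x" if "x \<in> ip_sphere ip p" "\<rho> x \<in> U" for x
    using ip_unitary[OF p s(2)[OF that(2)] that(1)] s(3)[OF that(2)] by (auto simp: G_def \<rho>_def)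
  have "ip (s P) (act (s P) u) = u" if "P \<in> U" "u \<in> G" for P u
    using s(2)[OF that(1)] that(2) unitary_iff[OF p] by (auto simp: ip_act_right ip_sphere_def G_def)
  moreover have "continuous_on (U \<times> G) \<phi>"
    unfolding \<phi>_def case_prod_beta
    by (intro continuous_on_act continuous_on_compose2[OF s(1)] continuous_intros) auto
  moreover have "continuous_on {x \<in> ip_sphere ip p. \<rho> x \<in> U} \<psi>"
  proof -
    have "continuous_on {x \<in> ip_sphere ip p. \<rho> x \<in> U} \<rho>"
      unfolding \<rho>_def by (intro continuous_on_theta continuous_intros)
    then show ?thesis unfolding \<psi>_def
      by (intro continuous_intros continuous_on_ip continuous_on_compose2[OF s(1)]) auto
  qed
  ultimately have "homeomorphic_maps (top_of_set (U \<times> G)) (top_of_set {x \<in> ip_sphere ip p. \<rho> x \<in> U}) \<phi> \<psi>"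
    using \<rho>\<phi> \<psi> by (auto simp: homeomorphic_maps_def \<phi>_def \<psi>_def)
  then have hom: "homeomorphic_map (top_of_set (U \<times> G)) (top_of_set {x \<in> ip_sphere ip p. \<rho> x \<in> U}) \<phi>"
    by (auto simp: homeomorphic_map_maps)
  \<comment> \<open>Relative openness: \<open>U\<close> is the trace of an open ball on the
    base.\<close>
  have "U = \<rho> ` ip_sphere ip p \<inter> ball (\<rho> e) (1/32)" by (auto simp: U_def \<rho>_def dist_commute)
  then have op: "openin (top_of_set (\<rho> ` ip_sphere ip p)) U" by (auto simp: openin_open)
  show ?thesis
    by (rule that[OF op _ hom]) (use e \<rho>\<phi> in \<open>auto simp: U_def \<rho>_def \<phi>_def act_act\<close>)
qed

end

theorem proposition2p4:
  fixes act :: "'x::complex_banach \<Rightarrow> 'a::cstar_algebra \<Rightarrow> 'x"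
    and ip :: "'x \<Rightarrow> 'x \<Rightarrow> 'a"
    and p :: 'a and x0 :: 'x
  assumes "hilbert_module act ip"
    and "full_module ip"
    and "projection p"
    and "x0 \<in> ip_sphere ip p"
  shows "principal_bundle (corner_unitary_group p)
           (top_of_set (carrier (corner_unitary_group p)))
           (top_of_set (ip_sphere ip p))
           (top_of_set (mvn_class act ip x0))
           act
           (\<lambda>x. theta act ip x x)"
proof -
  interpret hilbert_module act ip by fact
  note p = assms(3)
  let ?G = "corner_unitary_group p" and ?S = "ip_sphere ip p" and ?\<rho> = "\<lambda>x. theta act ip x x"
  interpret topological_group ?G "top_of_set (carrier ?G)"
    by (rule topological_group_corner_unitary[OF p])
  \<comment> \<open>Written as an image, the base makes surjectivity immediate and gives every base
    point a preimage \<open>e\<close> around which to trivialize.\<close>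
  have base: "mvn_class act ip x0 = ?\<rho> ` ?S"
    by (rule mvn_class_eq_image_theta[OF p assms(4)])
  have ops: "mult ?G = (*)" "one ?G = p" by (simp_all add: corner_unitary_group_def)
  have ct: "continuous_on (?S \<times> carrier ?G) (\<lambda>(x, u). act x u)"
    unfolding case_prod_beta by (intro continuous_on_act continuous_intros)
  have cp: "continuous_on ?S ?\<rho>" by (intro continuous_on_theta continuous_intros)
  show ?thesis
    unfolding base
  proof unfold_locales
    show "continuous_map (prod_topology (top_of_set ?S) (top_of_set (carrier ?G))) (top_of_set ?S) (\<lambda>(x, u). act x u)"
      using ct sphere_act_unitary(1)[OF p] by auto
    show "continuous_map (top_of_set ?S) (top_of_set (?\<rho> ` ?S)) ?\<rho>"
      using cp by auto
    show "?\<rho> ` topspace (top_of_set ?S) = topspace (top_of_set (?\<rho> ` ?S))" by simp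
  next
    fix x assume "x \<in> topspace (top_of_set ?S)"
    then show "act x \<one>\<^bsub>?G\<^esub> = x" using sphere_act_unit[OF p] by (simp add: ops)
  next
    fix x u v
    show "act (act x u) v = act x (u \<otimes>\<^bsub>?G\<^esub> v)" by (simp add: ops act_act)
  next
    fix x u assume "x \<in> topspace (top_of_set ?S)" "u \<in> carrier ?G" "act x u = x"
    \<comment> \<open>Pairing \<open>x u = x\<close> with \<open>x\<close> isolates the group
      element.\<close>
    then have "p = p * u" "p * u = u"
      using ip_act_right[of x x u] unitary_iff[OF p, of u] by (auto simp: ip_sphere_def)
    then show "u = \<one>\<^bsub>?G\<^esub>" unfolding ops by metis
  next
    fix x y assume "x \<in> topspace (top_of_set ?S)" "y \<in> topspace (top_of_set ?S)"
    then show "?\<rho> x = ?\<rho> y \<longleftrightarrow> (\<exists>u \<in> carrier ?G. y = act x u)"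
      using ip_unitary[OF p, of x y] sphere_act_unitary(2)[OF p, of x] by auto metis
  next
    fix P assume "P \<in> topspace (top_of_set (?\<rho> ` ?S))"
    then obtain e where e: "e \<in> ?S" and P: "P = ?\<rho> e" by auto
    obtain U \<phi> where U: "openin (top_of_set (?\<rho> ` ?S)) U" "?\<rho> e \<in> U"
      and hom: "homeomorphic_map (top_of_set (U \<times> carrier ?G)) (top_of_set {x \<in> ?S. ?\<rho> x \<in> U}) \<phi>"
      and \<phi>: "\<And>P u. \<lbrakk>P \<in> U; u \<in> carrier ?G\<rbrakk> \<Longrightarrow> ?\<rho> (\<phi> (P, u)) = P"
        "\<And>P u v. \<phi> (P, u * v) = act (\<phi> (P, u)) v"
      using local_trivialization[OF p e] by blast
    have "U \<subseteq> ?\<rho> ` ?S" using openin_subset[OF U(1)] by simp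
    \<comment> \<open>Iterated subspace topologies collapse to the single ones appearing in
      \<open>hom\<close>.\<close>
    then have "subtopology (top_of_set (?\<rho> ` ?S)) U = top_of_set U"
      "subtopology (top_of_set ?S) {x \<in> topspace (top_of_set ?S). ?\<rho> x \<in> U} = top_of_set {x \<in> ?S. ?\<rho> x \<in> U}"
      by (auto simp: subtopology_subtopology Int_absorb1 intro!: arg_cong[of _ _ top_of_set])
    then show "\<exists>U \<phi>. openin (top_of_set (?\<rho> ` ?S)) U \<and> P \<in> U \<and>
        homeomorphic_map (prod_topology (subtopology (top_of_set (?\<rho> ` ?S)) U) (top_of_set (carrier ?G)))
          (subtopology (top_of_set ?S) {x \<in> topspace (top_of_set ?S). ?\<rho> x \<in> U}) \<phi> \<and>
        (\<forall>c\<in>U. \<forall>g\<in>carrier ?G. ?\<rho> (\<phi> (c, g)) = c) \<and>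
        (\<forall>c\<in>U. \<forall>g\<in>carrier ?G. \<forall>h\<in>carrier ?G. \<phi> (c, g \<otimes>\<^bsub>?G\<^esub> h) = act (\<phi> (c, g)) h)"
      using U hom \<phi> by (intro exI[of _ U] exI[of _ \<phi>]) (simp add: P ops)
  qed
qed

end
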